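(* Let $p\in(0,1)$ and let $\mu(p)>0$ be the constant such that $\dfrac{\log_e e(P(n,p))-\mu(p)n}{\sigma(p)\sqrt{n}}$ converges in distribution to a standard normal for some $\sigma(p)>0$ (equivalently $\mu(p)=\lim_{n\to\infty}\mathbb{E}\bigl(\log_e e(P(n,p))\bigr)/n$). Let $h(p)=\Bigl(\sum_{j=1}^{\infty}(1-p)^{j(j-1)/2}\Bigr)^{-1}$. Then $$\mu(p)\ge -\frac{\log_2 h(p)\,\log_e 2}{2}.$$
   Context: The random graph order $P(n,p)$ is the poset on $\{1,\dots,n\}$ obtained from the Erdős–Rényi random graph $G(n,p)$ (each pair joined independently with probability $p$) by declaring $i\prec j$ if $i<j$ and $ij$ is an edge, and taking the transitive closure. $e(P)$ denotes the number of linear extensions of $P$. The existence of $\mu(p)$ and $\sigma(p)$ is a known result of Alon, Bollobás, Brightwell and Janson. *)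

theory Defs
  imports "HOL-Probability.Probability"
begin

text \<open>The edge \<open>{i, j}\<close> with \<open>i < j\<close> of a graph on \<open>{1..n}\<close> is encoded as the pair \<open>(i, j)\<close>.\<close>

definition vertex_pairs :: "nat \<Rightarrow> (nat \<times> nat) set" where
  "vertex_pairs n = {(i, j). 1 \<le> i \<and> i < j \<and> j \<le> n}"

definition random_graph :: "nat \<Rightarrow> real \<Rightarrow> (nat \<times> nat) set pmf" where
  "random_graph n p =
     map_pmf (\<lambda>b. {e \<in> vertex_pairs n. b e})
       (Pi_pmf (vertex_pairs n) False (\<lambda>_. bernoulli_pmf p))"

definition random_graph_order :: "nat \<Rightarrow> real \<Rightarrow> (nat \<times> nat) set pmf" where
  "random_graph_order n p = map_pmf trancl (random_graph n p)"

text \<open>The order \<open>R\<close> may be given as a strict or as a reflexive relation;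
  \<open>linear_order_on\<close> is reflexive.\<close>

definition linear_extensions :: "'a set \<Rightarrow> ('a \<times> 'a) set \<Rightarrow> ('a \<times> 'a) set set" where
  "linear_extensions A R = {L. linear_order_on A L \<and> R \<subseteq> L}"

definition num_linear_extensions :: "'a set \<Rightarrow> ('a \<times> 'a) set \<Rightarrow> nat" where
  "num_linear_extensions A R = card (linear_extensions A R)"

definition normalized_log_ext :: "real \<Rightarrow> real \<Rightarrow> nat \<Rightarrow> (nat \<times> nat) set \<Rightarrow> real" where
  "normalized_log_ext \<mu> \<sigma> n R =
     (ln (real (num_linear_extensions {1..n} R)) - \<mu> * real n) / (\<sigma> * sqrt (real n))"

definition clt_constants :: "real \<Rightarrow> real \<Rightarrow> real \<Rightarrow> bool" where
  "clt_constants p \<mu> \<sigma> \<longleftrightarrow>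
     weak_conv_m
       (\<lambda>n. distr (measure_pmf (random_graph_order n p)) borel (normalized_log_ext \<mu> \<sigma> n))
       std_normal_distribution"

definition h :: "real \<Rightarrow> real" where
  "h p = inverse (\<Sum>\<^sub>\<infinity>j\<in>{1::nat..}. (1 - p) ^ (j * (j - 1) div 2))"

end

theory Submission
  imports Defs "HOL-Combinatorics.Permutations"
begin

text \<open>Cut \<open>1, \<dots>, n\<close> greedily into intervals that are independent sets of the graph, starting a new
  block as soon as an edge would appear inside the current one. Permuting the vertices within blocks
  gives linear extensions, so a block of size \<open>m\<close> contributes a factor \<open>fact m \<ge> m powr (m / 2)\<close>,
  and convexity of \<open>x * ln x\<close> bounds \<open>ln e\<close> below by \<open>n / 2\<close> times the logarithm of the average block
  size. A block has size at least \<open>j\<close> with probability \<open>(1 - p) ^ (j * (j - 1) div 2)\<close>, hence mean size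
  \<open>inverse (h p)\<close>, and the expected number of blocks is asymptotically at most \<open>h p * n\<close>. By Markov's
  inequality the number of blocks is close to this bound or below it with probability bounded away
  from \<open>0\<close>, which is enough to bound the centring constant of the central limit theorem.\<close>

section \<open>Linear extensions from permutations preserving blocks\<close>

definition block_permutations :: "(nat \<Rightarrow> nat) \<Rightarrow> nat \<Rightarrow> (nat \<Rightarrow> nat) set" where
  "block_permutations f n = {\<pi>. \<pi> permutes {1..n} \<and> (\<forall>k\<in>{1..n}. f (\<pi> k) = f k)}"

lemma finite_block_permutations: "finite (block_permutations f n)"
  unfolding block_permutations_def by (rule finite_subset[OF _ finite_permutations]) auto

text \<open>A permutation of the first \<open>n\<close> vertices fixes \<open>Suc n\<close>, so
  following it by the transposition of \<open>Suc n\<close> and \<open>b\<close> sends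
  \<open>Suc n\<close> to \<open>b\<close>. Hence \<open>b\<close> can be read off, and then the
  permutation too. Labels are preserved because \<open>b\<close> and \<open>Suc n\<close> share
  theirs.\<close>

lemma card_block_permutations_Suc:
  assumes "B \<subseteq> {1..Suc n}" "\<And>b. b \<in> B \<Longrightarrow> f b = f (Suc n)"
  shows "card B * card (block_permutations f n) \<le> card (block_permutations f (Suc n))"
proof -
  let ?g = "\<lambda>(b, \<pi>). Transposition.transpose (Suc n) b \<circ> \<pi>"
  have last: "\<pi> (Suc n) = Suc n" if "\<pi> \<in> block_permutations f n" for \<pi>
    using that by (auto simp: block_permutations_def permutes_def)
  have "inj_on ?g (B \<times> block_permutations f n)"
  proof (rule inj_onI, clarsimp)
    fix b \<pi> c \<rho>
    assume *: "\<pi> \<in> block_permutations f n" "\<rho> \<in> block_permutations f n"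
      and eq: "Transposition.transpose (Suc n) b \<circ> \<pi> = Transposition.transpose (Suc n) c \<circ> \<rho>"
    have "b = (Transposition.transpose (Suc n) b \<circ> \<pi>) (Suc n)"
      using last[OF *(1)] by simp
    also have "\<dots> = c"
      unfolding eq using last[OF *(2)] by simp
    finally have bc: "b = c" .
    have "\<pi> x = \<rho> x" for x
      using fun_cong[OF eq, of x] unfolding bc comp_apply by (rule transpose_eq_imp_eq)
    with bc show "b = c \<and> \<pi> = \<rho>" by blast
  qed
  moreover have "?g ` (B \<times> block_permutations f n) \<subseteq> block_permutations f (Suc n)"
  proof clarsimp
    fix b \<pi> assume b: "b \<in> B" and \<pi>: "\<pi> \<in> block_permutations f n"
    have "\<pi> permutes {1..Suc n}"
      using \<pi> by (auto simp: block_permutations_def intro: permutes_subset)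
    moreover have "Transposition.transpose (Suc n) b permutes {1..Suc n}"
      using b assms(1) by (intro permutes_swap_id) auto
    ultimately have "(Transposition.transpose (Suc n) b \<circ> \<pi>) permutes {1..Suc n}"
      by (rule permutes_compose)
    moreover have "f (Transposition.transpose (Suc n) b (\<pi> k)) = f k" if "k \<in> {1..Suc n}" for k
    proof -
      have "f (\<pi> k) = f k"
        using \<pi> that by (cases "k = Suc n") (auto simp: last block_permutations_def)
      moreover have "f (Transposition.transpose (Suc n) b x) = f x" for x
        using assms(2)[OF b] by (auto simp: Transposition.transpose_def)
      ultimately show ?thesis by simp
    qed
    ultimately show "Transposition.transpose (Suc n) b \<circ> \<pi> \<in> block_permutations f (Suc n)"
      by (simp add: block_permutations_def)
  qed
  ultimately have "card (B \<times> block_permutations f n) \<le> card (block_permutations f (Suc n))"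
    by (intro card_inj_on_le finite_block_permutations)
  then show ?thesis by (simp add: card_cartesian_product)
qed

lemma linear_order_on_pullback:
  assumes "inj_on \<pi> A"
  shows "linear_order_on A {(x, y) \<in> A \<times> A. \<pi> x \<le> (\<pi> y :: 'b :: linorder)}"
  unfolding linear_order_on_def partial_order_on_def preorder_on_def
proof (intro conjI)
  show "antisym {(x, y) \<in> A \<times> A. \<pi> x \<le> \<pi> y}"
    using assms by (intro antisymI) (auto dest: inj_onD)
qed (auto simp: refl_on_def trans_def total_on_def)

text \<open>The value of the permutation at \<open>y\<close> is the rank of \<open>y\<close> in the
  induced order, so the order determines the permutation.\<close>

lemma permutation_order_inj:
  assumes "\<pi> permutes {1..n::nat}" "\<rho> permutes {1..n}"
    and eq: "{(x, y) \<in> {1..n} \<times> {1..n}. \<pi> x \<le> \<pi> y} = {(x, y) \<in> {1..n} \<times> {1..n}. \<rho> x \<le> \<rho> y}"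
  shows "\<pi> = \<rho>"
proof
  fix y
  have rank: "card {x\<in>{1..n}. \<tau> x \<le> \<tau> y} = \<tau> y" if \<tau>: "\<tau> permutes {1..n}" and y: "y \<in> {1..n}" for \<tau>
  proof -
    have ty: "\<tau> y \<in> {1..n}" using permutes_in_image[OF \<tau>] y by blast
    have "\<tau> ` {x\<in>{1..n}. \<tau> x \<le> \<tau> y} = {z \<in> \<tau> ` {1..n}. z \<le> \<tau> y}" by auto
    also have "\<dots> = {1..\<tau> y}" using permutes_image[OF \<tau>] ty by auto
    finally show ?thesis
      using card_image[OF permutes_inj_on[OF \<tau>], of "{x\<in>{1..n}. \<tau> x \<le> \<tau> y}"] by simp
  qed
  show "\<pi> y = \<rho> y"
  proof (cases "y \<in> {1..n}")
    case True
    have "{x\<in>{1..n}. \<pi> x \<le> \<pi> y} = {x\<in>{1..n}. \<rho> x \<le> \<rho> y}"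
      using arg_cong[OF eq, of "\<lambda>L. L\<inverse> `` {y}"] True by (simp add: Image_def)
    then show ?thesis using rank[OF assms(1) True] rank[OF assms(2) True] by simp
  next
    case False
    then show ?thesis using assms(1,2) by (simp add: permutes_def)
  qed
qed

lemma finite_linear_extensions:
  assumes "finite A"
  shows "finite (linear_extensions A R)"
proof (rule finite_subset)
  show "linear_extensions A R \<subseteq> Pow (A \<times> A)"
    by (auto simp: linear_extensions_def linear_order_on_def partial_order_on_def preorder_on_def)
qed (use assms in simp)

text \<open>Sorting the vertices by their images under such a permutation respects every edge: the
  ends of an edge have strictly increasing labels, and the permutation keeps labels. Transitivity of
  the sorted order extends this to \<open>E\<^sup>+\<close>.\<close>

lemma card_block_permutations_le_num_linear_extensions:
  assumes "E \<subseteq> vertex_pairs n" and "mono f" and "\<And>i j. (i, j) \<in> E \<Longrightarrow> f i \<noteq> f j"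
  shows "card (block_permutations f n) \<le> num_linear_extensions {1..n} (E\<^sup>+)"
proof -
  let ?L = "\<lambda>\<pi> :: nat \<Rightarrow> nat. {(x, y) \<in> {1..n} \<times> {1..n}. \<pi> x \<le> \<pi> y}"
  have "inj_on ?L (block_permutations f n)"
    by (intro inj_onI permutation_order_inj) (auto simp: block_permutations_def)
  moreover have "?L \<pi> \<in> linear_extensions {1..n} (E\<^sup>+)" if \<pi>: "\<pi> \<in> block_permutations f n" for \<pi>
  proof -
    have "\<pi> permutes {1..n}" using \<pi> by (simp add: block_permutations_def)
    then have lin: "linear_order_on {1..n} (?L \<pi>)"
      by (intro linear_order_on_pullback permutes_inj_on)
    have "E \<subseteq> ?L \<pi>"
    proof (rule subrelI)
      fix i j assume e: "(i, j) \<in> E"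
      then have ij: "i \<in> {1..n}" "j \<in> {1..n}" "i < j"
        using assms(1) by (auto simp: vertex_pairs_def)
      have "f i < f j"
        using assms(3)[OF e] monoD[OF \<open>mono f\<close>, of i j] ij by simp
      then have "f (\<pi> i) < f (\<pi> j)"
        using \<pi> ij by (simp add: block_permutations_def)
      then have "\<pi> i < \<pi> j"
        using monoD[OF \<open>mono f\<close>, of "\<pi> j" "\<pi> i"] by (meson leD not_le_imp_less)
      then show "(i, j) \<in> ?L \<pi>" using ij by simp
    qed
    moreover have "trans (?L \<pi>)" by (auto simp: trans_def)
    ultimately have "E\<^sup>+ \<subseteq> ?L \<pi>"
      using trancl_mono_subset[of E "?L \<pi>"] by (simp only: trancl_id)
    with lin show ?thesis by (simp add: linear_extensions_def)
  qed
  ultimately show ?thesis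
    unfolding num_linear_extensions_def
    by (intro card_inj_on_le[of ?L] finite_linear_extensions) auto
qed

section \<open>Greedy decomposition into antichains of consecutive vertices\<close>

text \<open>The vertex \<open>k\<close> lies in the block beginning at \<open>block_start E k\<close>. The value \<open>1\<close> at \<open>0\<close>
  denotes an empty block, which makes \<open>1\<close> the start of the first block.\<close>

primrec block_start :: "(nat \<times> nat) set \<Rightarrow> nat \<Rightarrow> nat" where
  "block_start E 0 = 1"
| "block_start E (Suc k) =
     (if \<exists>a\<in>{block_start E k..k}. (a, Suc k) \<in> E then Suc k else block_start E k)"

lemma block_start_le_Suc: "block_start E k \<le> Suc k"
  by (induction k) auto

lemma block_start_ge_1: "1 \<le> block_start E k"
  by (induction k) auto

lemma block_start_le: "1 \<le> k \<Longrightarrow> block_start E k \<le> k"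
  by (cases k) (auto simp: block_start_le_Suc)

lemma mono_block_start: "mono (block_start E)"
  unfolding mono_iff_le_Suc using block_start_le_Suc by auto

lemma block_start_eq:
  assumes "block_start E k \<le> i" "i \<le> k"
  shows "block_start E i = block_start E k"
  using assms by (induction k) (auto simp: le_Suc_eq split: if_splits)

text \<open>If \<open>i\<close> were in the block of \<open>j\<close>, it would already be in the
  block open at \<open>j - 1\<close>, and the edge would force a new block to start at
  \<open>j\<close>.\<close>

lemma block_start_neq_if_edge:
  assumes "(i, j) \<in> E" "i < j" "1 \<le> i"
  shows "block_start E i \<noteq> block_start E j"
proof
  assume eq: "block_start E i = block_start E j"
  obtain k where k: "j = Suc k" using assms(2) by (cases j) auto
  have "block_start E j \<le> i" using eq block_start_le[OF assms(3), of E] by simp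
  moreover from this have "block_start E k \<le> i"
    using assms(2) k by (auto split: if_splits)
  then have "block_start E j = j"
    using assms k by auto
  ultimately show False using assms(2) by simp
qed

text \<open>The greedy rule up to \<open>k\<close> never inspects an edge whose larger end exceeds
  \<open>k\<close>; this later gives independence from the edges arriving at
  \<open>Suc k\<close>.\<close>

lemma block_start_cong:
  assumes "\<And>a b. b \<le> k \<Longrightarrow> (a, b) \<in> E \<longleftrightarrow> (a, b) \<in> E'"
  shows "block_start E k = block_start E' k"
  using assms by (induction k) auto

lemma block_start_Suc_eq_iff:
  assumes "i \<le> k"
  shows "block_start E (Suc k) = i \<longleftrightarrow> block_start E k = i \<and> (\<forall>a\<in>{i..k}. (a, Suc k) \<notin> E)"
  using assms by auto

text \<open>The factor at \<open>k\<close> is the position of \<open>k\<close> inside its block, so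
  the product is that of the factorials of the block sizes. Each new vertex may be exchanged with
  any member of its block so far, itself included.\<close>

lemma prod_le_card_block_permutations:
  "(\<Prod>k=1..n. Suc k - block_start E k) \<le> card (block_permutations (block_start E) n)"
proof (induction n)
  case 0
  have "block_permutations (block_start E) 0 = {id}"
    by (auto simp: block_permutations_def)
  then show ?case by simp
next
  case (Suc n)
  let ?B = "{block_start E (Suc n)..Suc n}"
  have "card ?B * card (block_permutations (block_start E) n)
      \<le> card (block_permutations (block_start E) (Suc n))"
    using block_start_ge_1[of E "Suc n"]
    by (intro card_block_permutations_Suc) (auto intro: block_start_eq simp del: block_start.simps)
  moreover have "(\<Prod>k=1..Suc n. Suc k - block_start E k)
      = card ?B * (\<Prod>k=1..n. Suc k - block_start E k)"
    by (simp del: block_start.simps)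
  ultimately show ?case
    using mult_le_mono2[OF Suc.IH] by (metis order.trans)
qed

lemma prod_le_num_linear_extensions:
  assumes "E \<subseteq> vertex_pairs n"
  shows "(\<Prod>k=1..n. Suc k - block_start E k) \<le> num_linear_extensions {1..n} (E\<^sup>+)"
  using assms
  by (intro order.trans[OF prod_le_card_block_permutations]
      card_block_permutations_le_num_linear_extensions mono_block_start block_start_neq_if_edge)
    (auto simp: vertex_pairs_def)

section \<open>Lower bound on the logarithm in terms of the number of blocks\<close>

definition num_blocks :: "(nat \<times> nat) set \<Rightarrow> nat \<Rightarrow> nat" where
  "num_blocks E n = card {i\<in>{1..n}. block_start E i = i}"

lemma num_blocks_eq_sum: "real (num_blocks E n) = (\<Sum>i=1..n. of_bool (block_start E i = i))"
  unfolding num_blocks_def by (simp add: Int_def)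

lemma power_self_le_fact_square: "m ^ m \<le> (fact m)\<^sup>2"
proof -
  have "(\<Prod>k=1..m. m) \<le> (\<Prod>k=1..m. k * (m + 1 - k))"
  proof (rule prod_mono, intro conjI)
    fix k assume "k \<in> {1..m}"
    then have "k = Suc (k - 1)" "m = Suc (k - 1 + (m - k))" by auto
    then obtain r s where "k = Suc r" "m = Suc (r + s)" by blast
    \<comment> \<open>In terms of \<open>r\<close> and \<open>s\<close> this reads
      \<open>r + s + 1 \<le> (r + 1) * (s + 1)\<close>.\<close>
    then show "m \<le> k * (m + 1 - k)" by (simp add: algebra_simps)
  qed simp
  also have "\<dots> = (\<Prod>k=1..m. k) * (\<Prod>k=1..m. m + 1 - k)"
    by (rule prod.distrib)
  also have "\<dots> = (fact m)\<^sup>2"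
    using prod.atLeastAtMost_rev[of "\<lambda>k. k" 1 m] by (simp add: fact_prod power2_eq_square)
  finally show ?thesis by simp
qed

text \<open>Since \<open>m ^ m \<le> (fact m)\<^sup>2\<close>, this follows by replacing the convex function
  \<open>\<lambda>x. x * ln x\<close> with its tangent at \<open>c\<close>.\<close>

lemma ln_fact_ge_tangent:
  assumes "0 < c"
  shows "ln (fact m :: real) \<ge> ((1 + ln c) * real m - c) / 2"
proof (cases "m = 0")
  case False
  have "ln (c / m) \<le> c / m - 1"
    using assms False by (intro ln_le_minus_one) simp
  then have "real m * ln (c / m) \<le> real m * (c / m - 1)"
    by (intro mult_left_mono) auto
  then have "(1 + ln c) * real m - c \<le> real m * ln (real m)"
    using assms False by (simp add: ln_div algebra_simps)
  also have "\<dots> = ln (real (m ^ m))"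
    using False by (simp add: ln_realpow)
  also have "\<dots> \<le> ln (real ((fact m)\<^sup>2))"
    using power_self_le_fact_square[of m] False by (intro ln_mono of_nat_mono) auto
  also have "\<dots> = 2 * ln (fact m)"
    by (simp add: ln_realpow)
  finally show ?thesis by simp
qed (use assms in simp)

lemma sum_ln_ge_num_blocks:
  assumes "0 < c" "1 \<le> n"
  shows "(\<Sum>k=1..n. ln (real (Suc k - block_start E k)))
    \<ge> ((1 + ln c) * real n - c * real (num_blocks E n)) / 2"
proof -
  let ?s = "block_start E"
  \<comment> \<open>The induction keeps the last, still open block exact as a factorial and uses the
    tangent bound only for the \<open>num_blocks E n - 1\<close> closed blocks, which cover the
    \<open>?s n - 1\<close> vertices before it.\<close>
  have "(\<Sum>k=1..n. ln (real (Suc k - ?s k)))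
    \<ge> ((1 + ln c) * (real (?s n) - 1) - c * (real (num_blocks E n) - 1)) / 2
      + ln (fact (Suc n - ?s n))"
    using \<open>1 \<le> n\<close>
  proof (induction n rule: nat_induct_at_least)
    case base
    show ?case by (simp add: num_blocks_eq_sum)
  next
    case (Suc n)
    have sn: "?s n \<le> n" using block_start_le Suc.hyps by simp
    show ?case
    proof (cases "?s (Suc n) = Suc n")
      case True
      \<comment> \<open>A block of \<open>Suc n - ?s n\<close> vertices has just been closed; its
        factorial is now traded for the tangent bound, at the cost of one more
        \<open>c\<close>.\<close>
      have "real (num_blocks E (Suc n)) - 1 = (real (num_blocks E n) - 1) + 1"
        using True by (simp add: num_blocks_eq_sum del: block_start.simps)
      then have "c * (real (num_blocks E (Suc n)) - 1) = c * (real (num_blocks E n) - 1) + c"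
        by (simp only: distrib_left)
      moreover have "(1 + ln c) * (real (Suc n) - 1)
          = (1 + ln c) * (real (?s n) - 1) + (1 + ln c) * real (Suc n - ?s n)"
        using sn by (subst distrib_left[symmetric]) simp
      moreover have "(\<Sum>k=1..Suc n. ln (real (Suc k - ?s k)))
          = (\<Sum>k=1..n. ln (real (Suc k - ?s k)))"
        using True by (simp del: block_start.simps)
      moreover have "ln (fact (Suc (Suc n) - ?s (Suc n)) :: real) = 0"
        using True by (simp del: block_start.simps)
      ultimately show ?thesis
        using Suc.IH ln_fact_ge_tangent[OF \<open>0 < c\<close>, of "Suc n - ?s n"]
        unfolding True by argo
    next
      case False
      then have s: "?s (Suc n) = ?s n" by (auto split: if_splits)
      have "real (num_blocks E (Suc n)) = real (num_blocks E n)"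
        using False by (simp add: num_blocks_eq_sum del: block_start.simps)
      moreover have "Suc (Suc n) - ?s n = Suc (Suc n - ?s n)" using sn by simp
      moreover have "ln (fact (Suc (Suc n - ?s n)) :: real)
          = ln (real (Suc (Suc n - ?s n))) + ln (fact (Suc n - ?s n))"
        by (simp add: ln_mult del: of_nat_Suc)
      ultimately show ?thesis
        using Suc.IH s by (simp del: block_start.simps fact_Suc)
    qed
  qed
  moreover have "(1 + ln c) * real n
      = (1 + ln c) * (real (?s n) - 1) + (1 + ln c) * real (Suc n - ?s n)"
    using block_start_le[OF \<open>1 \<le> n\<close>, of E] by (subst distrib_left[symmetric]) simp
  moreover have "c * (real (num_blocks E n) - 1) = c * real (num_blocks E n) - c"
    by (simp add: right_diff_distrib)
  ultimately show ?thesis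
    using ln_fact_ge_tangent[OF \<open>0 < c\<close>, of "Suc n - ?s n"] by argo
qed

text \<open>The parameter \<open>c\<close> stays free here; it will be
  \<open>mean_block_size p m\<close>, a proxy for the average block size.\<close>

lemma ln_num_linear_extensions_ge:
  assumes "E \<subseteq> vertex_pairs n" "0 < c" "1 \<le> n"
  shows "ln (real (num_linear_extensions {1..n} (E\<^sup>+)))
    \<ge> ((1 + ln c) * real n - c * real (num_blocks E n)) / 2"
proof -
  have pos: "0 < Suc k - block_start E k" if "k \<in> {1..n}" for k
    using that block_start_le[of k E] by simp
  then have "0 < (\<Prod>k=1..n. Suc k - block_start E k)"
    by (intro prod_pos) simp
  then have "ln (real (\<Prod>k=1..n. Suc k - block_start E k))
      \<le> ln (real (num_linear_extensions {1..n} (E\<^sup>+)))"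
    using prod_le_num_linear_extensions[OF assms(1)]
    by (intro ln_mono of_nat_mono) (simp_all only: of_nat_0_less_iff)
  moreover have "ln (real (\<Prod>k=1..n. Suc k - block_start E k))
      = (\<Sum>k=1..n. ln (real (Suc k - block_start E k)))"
    unfolding of_nat_prod by (intro ln_prod) (auto dest!: pos simp only: of_nat_0_less_iff)
  ultimately show ?thesis
    using sum_ln_ge_num_blocks[OF assms(2,3), of E] by simp
qed


section \<open>The number of greedy blocks of a random graph\<close>

lemma finite_vertex_pairs: "finite (vertex_pairs n)"
  by (rule finite_subset[of _ "{1..n} \<times> {1..n}"]) (auto simp: vertex_pairs_def)

lemma set_random_graph_subset: "E \<in> set_pmf (random_graph n p) \<Longrightarrow> E \<subseteq> vertex_pairs n"
  by (auto simp: random_graph_def)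

lemma prob_pair_pmf_Times:
  "measure_pmf.prob (pair_pmf M N) (A \<times> B) = measure_pmf.prob M A * measure_pmf.prob N B"
proof -
  \<comment> \<open>Intersecting with the supports makes both factors countable.\<close>
  have "measure_pmf.prob (pair_pmf M N) (A \<times> B)
      = measure_pmf.prob (pair_pmf M N) ((A \<times> B) \<inter> set_pmf (pair_pmf M N))"
    by (rule measure_Int_set_pmf[symmetric])
  also have "(A \<times> B) \<inter> set_pmf (pair_pmf M N) = (A \<inter> set_pmf M) \<times> (B \<inter> set_pmf N)"
    by auto
  also have "measure_pmf.prob (pair_pmf M N) \<dots>
      = measure_pmf.prob M (A \<inter> set_pmf M) * measure_pmf.prob N (B \<inter> set_pmf N)"
    by (intro measure_pmf_prob_product countable_Int2) auto
  finally show ?thesis by (simp add: measure_Int_set_pmf)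
qed

text \<open>The hypothesis on \<open>X\<close> says that it ignores the pairs in \<open>B\<close>.
  The edge indicators inside and outside \<open>B\<close> are independent, so the probability
  factors.\<close>

lemma prob_random_graph_no_edges:
  assumes "0 \<le> p" "p \<le> 1" and B: "B \<subseteq> vertex_pairs n" and X: "\<And>E. X (E - B) \<longleftrightarrow> X E"
  shows "measure_pmf.prob (random_graph n p) {E. X E \<and> E \<inter> B = {}}
    = measure_pmf.prob (random_graph n p) {E. X E} * (1 - p) ^ card B"
proof -
  define A where "A = vertex_pairs n - B"
  let ?P = "\<lambda>C. Pi_pmf C False (\<lambda>_. bernoulli_pmf p)"
  let ?F = "{f. X {e \<in> A. f e}}"
  have AB: "vertex_pairs n = A \<union> B" "A \<inter> B = {}" "finite A" "finite B"
    using B finite_vertex_pairs[of n] by (auto simp: A_def intro: finite_subset)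
  have "random_graph n p = map_pmf (\<lambda>(f, g). {e \<in> A. f e} \<union> {e \<in> B. g e}) (pair_pmf (?P A) (?P B))"
    unfolding random_graph_def AB(1) Pi_pmf_union[OF AB(3,4,2)] pmf.map_comp
    using AB(2) by (intro map_pmf_cong) auto
  then have prob: "measure_pmf.prob (random_graph n p) S
      = measure_pmf.prob (pair_pmf (?P A) (?P B)) {(f, g). {e \<in> A. f e} \<union> {e \<in> B. g e} \<in> S}" for S
    by (simp add: vimage_def case_prod_unfold)
  have X_union: "X ({e \<in> A. f e} \<union> {e \<in> B. g e}) \<longleftrightarrow> X {e \<in> A. f e}" for f g
  proof -
    have "({e \<in> A. f e} \<union> {e \<in> B. g e}) - B = {e \<in> A. f e}" using AB(2) by auto
    then show ?thesis using X[of "{e \<in> A. f e} \<union> {e \<in> B. g e}"] by simp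
  qed
  have "{(f, g). {e \<in> A. f e} \<union> {e \<in> B. g e} \<in> {E. X E \<and> E \<inter> B = {}}} = ?F \<times> Pi B (\<lambda>_. {False})"
    using AB(2) by (auto simp: X_union)
  then have "measure_pmf.prob (random_graph n p) {E. X E \<and> E \<inter> B = {}}
      = measure_pmf.prob (?P A) ?F * measure_pmf.prob (?P B) (Pi B (\<lambda>_. {False}))"
    unfolding prob by (simp only: prob_pair_pmf_Times)
  moreover have "{(f, g). {e \<in> A. f e} \<union> {e \<in> B. g e} \<in> {E. X E}} = ?F \<times> UNIV"
    by (auto simp: X_union)
  then have "measure_pmf.prob (random_graph n p) {E. X E} = measure_pmf.prob (?P A) ?F"
    unfolding prob by (simp add: prob_pair_pmf_Times)
  moreover have "measure_pmf.prob (?P B) (Pi B (\<lambda>_. {False})) = (1 - p) ^ card B"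
    using assms(1,2) by (simp add: measure_Pi_pmf_Pi AB(4) measure_pmf_single)
  ultimately show ?thesis by simp
qed

section \<open>Renewal inequality for the block starts\<close>

definition block_start_prob :: "nat \<Rightarrow> real \<Rightarrow> nat \<Rightarrow> real" where
  "block_start_prob n p i = measure_pmf.prob (random_graph n p) {E. block_start E i = i}"

text \<open>The probability that \<open>j\<close> given vertices span no edge.\<close>

definition antichain_prob :: "real \<Rightarrow> nat \<Rightarrow> real" where
  "antichain_prob p j = (1 - p) ^ (j * (j - 1) div 2)"

lemma antichain_prob_Suc: "antichain_prob p (Suc j) = antichain_prob p j * (1 - p) ^ j"
proof -
  have "Suc j * (Suc j - 1) div 2 = j * (j - 1) div 2 + j"
  proof (cases j)
    case (Suc m)
    have "Suc j * (Suc j - 1) = j * (j - 1) + j * 2" by (simp add: Suc)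
    then show ?thesis by simp
  qed simp
  then show ?thesis by (simp add: antichain_prob_def power_add)
qed

text \<open>The block started at \<open>i\<close> survives the arrival of \<open>Suc k\<close>
  exactly when \<open>Suc k\<close> is joined to none of \<open>i, ..., k\<close>. These
  \<open>Suc k - i\<close> pairs are independent of what happened up to \<open>k\<close>, so each
  arrival contributes a power of \<open>1 - p\<close>.\<close>

lemma prob_block_start:
  assumes "0 \<le> p" "p \<le> 1" "1 \<le> i" "i \<le> k" "k \<le> n"
  shows "measure_pmf.prob (random_graph n p) {E. block_start E k = i}
    = block_start_prob n p i * antichain_prob p (Suc k - i)"
  using \<open>i \<le> k\<close> \<open>k \<le> n\<close>
proof (induction k rule: dec_induct)
  case base
  show ?case by (simp add: block_start_prob_def antichain_prob_def)
next
  case (step k)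
  let ?B = "{i..k} \<times> {Suc k}"
  have "{E. block_start E (Suc k) = i} = {E. block_start E k = i \<and> E \<inter> ?B = {}}"
    using block_start_Suc_eq_iff[OF step.hyps(1)] by blast
  also have "measure_pmf.prob (random_graph n p) \<dots>
      = measure_pmf.prob (random_graph n p) {E. block_start E k = i} * (1 - p) ^ card ?B"
  proof (rule prob_random_graph_no_edges)
    show "?B \<subseteq> vertex_pairs n"
      using step assms(3) by (auto simp: vertex_pairs_def)
    show "(block_start (E - ?B) k = i) \<longleftrightarrow> (block_start E k = i)" for E
      by (subst block_start_cong[of k "E - ?B" E]) auto
  qed (use assms in auto)
  also have "\<dots> = block_start_prob n p i * antichain_prob p (Suc (Suc k) - i)"
    using step by (simp add: Suc_diff_le antichain_prob_Suc)
  finally show ?case .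
qed

text \<open>The summands are the probabilities of the events that \<open>k\<close> lies in the block
  started at \<open>i\<close>, which are disjoint for distinct \<open>i\<close>.\<close>

lemma sum_block_start_prob_le_1:
  assumes "0 \<le> p" "p \<le> 1" "k \<le> n"
  shows "(\<Sum>i=1..k. block_start_prob n p i * antichain_prob p (Suc k - i)) \<le> 1"
proof -
  have "(\<Sum>i=1..k. block_start_prob n p i * antichain_prob p (Suc k - i))
      = (\<Sum>i=1..k. measure_pmf.prob (random_graph n p) {E. block_start E k = i})"
    using assms by (intro sum.cong) (simp_all add: prob_block_start)
  also have "\<dots> = measure_pmf.prob (random_graph n p) (\<Union>i\<in>{1..k}. {E. block_start E k = i})"
    by (intro measure_pmf.finite_measure_finite_Union[symmetric]) (auto simp: disjoint_family_on_def)
  also have "\<dots> \<le> 1" by simp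
  finally show ?thesis .
qed

lemma expectation_num_blocks:
  "measure_pmf.expectation (random_graph n p) (\<lambda>E. real (num_blocks E n))
    = (\<Sum>i=1..n. block_start_prob n p i)"
proof -
  have *: "of_bool (block_start E i = i) = (indicator {E. block_start E i = i} E :: real)" for E i
    by (simp add: indicator_def)
  show ?thesis
    unfolding num_blocks_eq_sum * block_start_prob_def
    by (subst Bochner_Integration.integral_sum)
      (auto intro!: measure_pmf.integrable_const_bound[where B = 1])
qed

text \<open>By the tail sum formula this is the mean of a block size truncated at \<open>m\<close>.
  Truncation confines the boundary effect at \<open>n\<close> to fewer than \<open>m\<close>
  starting points.\<close>

definition mean_block_size :: "real \<Rightarrow> nat \<Rightarrow> real" where
  "mean_block_size p m = (\<Sum>j=1..m. antichain_prob p j)"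

lemma antichain_prob_nonneg: "p \<le> 1 \<Longrightarrow> 0 \<le> antichain_prob p j"
  by (simp add: antichain_prob_def)

lemma mean_block_size_mono: "p \<le> 1 \<Longrightarrow> m \<le> m' \<Longrightarrow> mean_block_size p m \<le> mean_block_size p m'"
  unfolding mean_block_size_def by (intro sum_mono2) (auto simp: antichain_prob_nonneg)

lemma mean_block_size_ge_1:
  assumes "p \<le> 1" "1 \<le> m"
  shows "1 \<le> mean_block_size p m"
  using mean_block_size_mono[OF assms] by (simp add: mean_block_size_def antichain_prob_def)

text \<open>Every vertex lies in some block, and a block starting at \<open>i\<close> contains on average
  \<open>mean_block_size p (Suc n - i)\<close> of the vertices up to \<open>n\<close>.\<close>

lemma sum_block_start_prob_mean_block_size:
  assumes "0 \<le> p" "p \<le> 1"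
  shows "(\<Sum>i=1..n. block_start_prob n p i * mean_block_size p (Suc n - i)) \<le> real n"
proof -
  let ?g = "\<lambda>i k. block_start_prob n p i * antichain_prob p (Suc k - i)"
  have "(\<Sum>i=1..n. block_start_prob n p i * mean_block_size p (Suc n - i))
      = (\<Sum>i=1..n. \<Sum>k\<in>{k\<in>{1..n}. i \<le> k}. ?g i k)"
  proof (rule sum.cong)
    fix i assume "i \<in> {1..n}"
    then have "mean_block_size p (Suc n - i) = (\<Sum>k\<in>{k\<in>{1..n}. i \<le> k}. antichain_prob p (Suc k - i))"
      unfolding mean_block_size_def
      by (intro sum.reindex_bij_witness[of _ "\<lambda>k. Suc k - i" "\<lambda>j. j + i - 1"]) auto
    then show "block_start_prob n p i * mean_block_size p (Suc n - i)
        = (\<Sum>k\<in>{k\<in>{1..n}. i \<le> k}. ?g i k)"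
      by (simp add: sum_distrib_left)
  qed simp
  also have "\<dots> = (\<Sum>k=1..n. \<Sum>i\<in>{i\<in>{1..n}. i \<le> k}. ?g i k)"
    by (rule sum.swap_restrict) auto
  also have "\<dots> = (\<Sum>k=1..n. \<Sum>i=1..k. ?g i k)"
    by (intro sum.cong) auto
  also have "\<dots> \<le> (\<Sum>k=1..n. 1)"
    using assms by (intro sum_mono sum_block_start_prob_le_1) auto
  finally show ?thesis by simp
qed

text \<open>A block starting at least \<open>m\<close> places before the end has room for its
  truncated mean, so the preceding bound applies to it. Each of the fewer than \<open>m\<close>
  remaining starts is bounded by probability one, which gives the error term.\<close>

lemma mean_block_size_mult_expectation_num_blocks_le:
  assumes "0 \<le> p" "p \<le> 1"
  shows "mean_block_size p m * measure_pmf.expectation (random_graph n p) (\<lambda>E. real (num_blocks E n))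
    \<le> real n + mean_block_size p m * real m"
proof -
  let ?T = "mean_block_size p"
  have T: "0 \<le> ?T j" for j
    using assms by (auto simp: mean_block_size_def antichain_prob_nonneg intro!: sum_nonneg)
  have u: "0 \<le> block_start_prob n p i" "block_start_prob n p i \<le> 1" for i
    by (simp_all add: block_start_prob_def)
  have "?T m * block_start_prob n p i
      \<le> block_start_prob n p i * ?T (Suc n - i) + ?T m * of_bool (Suc n - i < m)" for i
  proof (cases "Suc n - i < m")
    case True
    have "?T m * block_start_prob n p i \<le> ?T m"
      using mult_left_mono[OF u(2) T] by simp
    moreover have "0 \<le> block_start_prob n p i * ?T (Suc n - i)"
      using u(1) T by simp
    ultimately show ?thesis using True by simp
  next
    case False
    then show ?thesis
      using mult_left_mono[OF mean_block_size_mono[OF assms(2), of m "Suc n - i"] u(1)[of i]]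
      by (simp add: mult.commute)
  qed
  then have "(\<Sum>i=1..n. ?T m * block_start_prob n p i)
      \<le> (\<Sum>i=1..n. block_start_prob n p i * ?T (Suc n - i) + ?T m * of_bool (Suc n - i < m))"
    by (intro sum_mono)
  also have "\<dots> = (\<Sum>i=1..n. block_start_prob n p i * ?T (Suc n - i))
      + ?T m * real (card ({1..n} \<inter> {i. Suc n - i < m}))"
    by (simp add: sum.distrib sum_distrib_left[symmetric])
  also have "\<dots> \<le> real n + ?T m * real m"
  proof (intro add_mono mult_left_mono T sum_block_start_prob_mean_block_size assms of_nat_mono)
    have "{1..n} \<inter> {i. Suc n - i < m} \<subseteq> {Suc n - m..<Suc n}" by auto
    then have "card ({1..n} \<inter> {i. Suc n - i < m}) \<le> card {Suc n - m..<Suc n}"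
      by (intro card_mono) auto
    then show "card ({1..n} \<inter> {i. Suc n - i < m}) \<le> m" by simp
  qed
  finally show ?thesis
    by (simp add: expectation_num_blocks sum_distrib_left)
qed

text \<open>For such \<open>n\<close> the scaled expectation is at most
  \<open>(1 + \<epsilon>) * n\<close>, so Markov's inequality at the threshold
  \<open>(1 + 2 * \<epsilon>) * n\<close> leaves a positive probability for the complement that does
  not depend on \<open>n\<close>.\<close>

lemma prob_num_blocks_ge:
  assumes "0 \<le> p" "p \<le> 1" "0 < \<epsilon>" "1 \<le> m" "1 \<le> n"
    and n: "mean_block_size p m * real m \<le> \<epsilon> * real n"
  shows "measure_pmf.prob (random_graph n p)
      {E. mean_block_size p m * real (num_blocks E n) < (1 + 2 * \<epsilon>) * real n} \<ge> \<epsilon> / (1 + 2 * \<epsilon>)"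
proof -
  let ?G = "measure_pmf (random_graph n p)" and ?c = "mean_block_size p m"
  let ?S = "{E. (1 + 2 * \<epsilon>) * real n \<le> ?c * real (num_blocks E n)}"
  have "num_blocks E n \<le> n" for E
    unfolding num_blocks_def by (rule order.trans[OF card_mono[of "{1..n}"]]) auto
  then have int: "integrable ?G (\<lambda>E. real (num_blocks E n))"
    by (intro measure_pmf.integrable_const_bound[where B = "real n"]) auto
  have "measure ?G ?S \<le> (\<integral>E. ?c * real (num_blocks E n) \<partial>?G) / ((1 + 2 * \<epsilon>) * real n)"
    using integral_Markov_inequality_measure[of ?G "\<lambda>E. ?c * real (num_blocks E n)" UNIV "(1 + 2 * \<epsilon>) * real n"]
      assms int mean_block_size_ge_1[OF assms(2,4)] by simp
  also have "\<dots> \<le> ((1 + \<epsilon>) * real n) / ((1 + 2 * \<epsilon>) * real n)"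
    using mean_block_size_mult_expectation_num_blocks_le[OF assms(1,2), of m n] n assms(3)
    by (intro divide_right_mono) (auto simp: algebra_simps)
  also have "\<dots> = (1 + \<epsilon>) / (1 + 2 * \<epsilon>)"
    using assms by simp
  also have "\<dots> = 1 - \<epsilon> / (1 + 2 * \<epsilon>)"
    using assms by (simp add: field_simps)
  finally have "measure ?G ?S \<le> 1 - \<epsilon> / (1 + 2 * \<epsilon>)" .
  moreover have "{E. ?c * real (num_blocks E n) < (1 + 2 * \<epsilon>) * real n} = UNIV - ?S" by auto
  ultimately show ?thesis
    using measure_pmf.prob_compl[of ?S "random_graph n p"] by simp
qed

lemma prob_ln_num_linear_extensions_ge:
  assumes "0 \<le> p" "p \<le> 1" "0 < \<epsilon>" "1 \<le> m" "1 \<le> n"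
    and "mean_block_size p m * real m \<le> \<epsilon> * real n"
  shows "measure_pmf.prob (random_graph_order n p)
      {R. (ln (mean_block_size p m) / 2 - \<epsilon>) * real n \<le> ln (real (num_linear_extensions {1..n} R))}
      \<ge> \<epsilon> / (1 + 2 * \<epsilon>)"
proof -
  let ?c = "mean_block_size p m" and ?G = "random_graph n p"
  let ?S = "{E. ?c * real (num_blocks E n) < (1 + 2 * \<epsilon>) * real n}"
  let ?L = "{E. (ln ?c / 2 - \<epsilon>) * real n \<le> ln (real (num_linear_extensions {1..n} (E\<^sup>+)))}"
  have "?S \<inter> set_pmf ?G \<subseteq> ?L"
  proof clarify
    fix E assume E: "?c * real (num_blocks E n) < (1 + 2 * \<epsilon>) * real n" "E \<in> set_pmf ?G"
    have "(ln ?c / 2 - \<epsilon>) * real n = ((1 + ln ?c) * real n - (1 + 2 * \<epsilon>) * real n) / 2"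
      by (simp add: algebra_simps)
    also have "\<dots> \<le> ((1 + ln ?c) * real n - ?c * real (num_blocks E n)) / 2"
      using E(1) by simp
    also have "\<dots> \<le> ln (real (num_linear_extensions {1..n} (E\<^sup>+)))"
      using E(2) assms mean_block_size_ge_1[OF assms(2,4)]
      by (intro ln_num_linear_extensions_ge set_random_graph_subset) auto
    finally show "(ln ?c / 2 - \<epsilon>) * real n \<le> ln (real (num_linear_extensions {1..n} (E\<^sup>+)))" .
  qed
  then have "measure_pmf.prob ?G (?S \<inter> set_pmf ?G) \<le> measure_pmf.prob ?G ?L"
    by (intro measure_pmf.finite_measure_mono) auto
  then show ?thesis
    using prob_num_blocks_ge[OF assms]
    by (simp add: measure_Int_set_pmf random_graph_order_def vimage_def)
qed

section \<open>Comparison with the central limit theorem\<close>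

text \<open>If \<open>a\<close> exceeded \<open>\<mu>\<close>, the normalized variable would be at
  least a multiple of \<open>sqrt n\<close> tending to infinity with probability at least
  \<open>\<delta>\<close>, whereas in the limit its mass beyond a suitable fixed \<open>x\<close> is
  less than \<open>\<delta>\<close>.\<close>

lemma le_if_clt_constants:
  assumes clt: "clt_constants p \<mu> \<sigma>" and "0 < \<sigma>" "0 < \<delta>"
    and ev: "eventually (\<lambda>n. measure_pmf.prob (random_graph_order n p)
      {R. a * real n \<le> ln (real (num_linear_extensions {1..n} R))} \<ge> \<delta>) sequentially"
  shows "a \<le> \<mu>"
proof (rule ccontr)
  assume "\<not> a \<le> \<mu>"
  then have a: "0 < (a - \<mu>) / \<sigma>" using \<open>0 < \<sigma>\<close> by simp
  let ?N = "std_normal_distribution"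
  interpret N: real_distribution ?N by (rule real_dist_normal_dist)
  have "eventually (\<lambda>x. 1 - \<delta> < cdf ?N x) at_top"
    using N.cdf_lim_at_top_prob \<open>0 < \<delta>\<close> by (intro order_tendstoD) auto
  then obtain x where x: "1 - \<delta> < cdf ?N x"
    using eventually_happens'[OF trivial_limit_at_top_linorder] by blast
  \<comment> \<open>Weak convergence gives convergence of the distribution functions only at
    continuity points; the normal law has no atoms, so \<open>x\<close> is one.\<close>
  have "{x} \<in> null_sets ?N"
  proof (subst null_sets_density_iff, safe)
    show "AE y in lborel. y \<in> {x} \<longrightarrow> ennreal (std_normal_density y) = 0"
      using AE_lborel_singleton[of x] by eventually_elim simp
  qed auto
  then have "isCont (cdf ?N) x"
    by (simp add: N.isCont_cdf measure_eq_0_null_sets)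
  then have "(\<lambda>n. cdf (distr (measure_pmf (random_graph_order n p)) borel (normalized_log_ext \<mu> \<sigma> n)) x)
      \<longlonglongrightarrow> cdf ?N x"
    using clt by (simp add: clt_constants_def weak_conv_m_def weak_conv_def)
  then have "eventually (\<lambda>n. 1 - \<delta> < cdf (distr (measure_pmf (random_graph_order n p)) borel
      (normalized_log_ext \<mu> \<sigma> n)) x) sequentially"
    using x by (rule order_tendstoD)
  moreover have "filterlim (\<lambda>n. (a - \<mu>) / \<sigma> * sqrt (real n)) at_top sequentially"
    using a by (intro filterlim_tendsto_pos_mult_at_top[OF tendsto_const]
        filterlim_compose[OF sqrt_at_top filterlim_real_sequentially])
  then have "eventually (\<lambda>n. x < (a - \<mu>) / \<sigma> * sqrt (real n)) sequentially"
    by (simp add: filterlim_at_top_dense)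
  ultimately have "eventually (\<lambda>n. False) sequentially"
    using ev eventually_ge_at_top[of 1]
  proof eventually_elim
    case (elim n)
    let ?P = "random_graph_order n p"
    let ?A = "{R. normalized_log_ext \<mu> \<sigma> n R \<le> x}"
    let ?B = "{R. a * real n \<le> ln (real (num_linear_extensions {1..n} R))}"
    have "1 - \<delta> < measure_pmf.prob ?P ?A"
      using elim(1) by (simp add: cdf_def measure_distr vimage_def)
    moreover have "?A \<inter> ?B = {}"
    proof (rule equals0I)
      fix R assume R: "R \<in> ?A \<inter> ?B"
      have "(a - \<mu>) / \<sigma> * sqrt (real n) = (a * real n - \<mu> * real n) / (\<sigma> * sqrt (real n))"
        using elim(4) \<open>0 < \<sigma>\<close> by (simp add: field_simps)
      also have "\<dots> \<le> normalized_log_ext \<mu> \<sigma> n R"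
        unfolding normalized_log_ext_def using R \<open>0 < \<sigma>\<close> by (intro divide_right_mono) auto
      also have "\<dots> \<le> x" using R by simp
      finally show False using elim(2) by simp
    qed
    then have "measure_pmf.prob ?P ?A + measure_pmf.prob ?P ?B = measure_pmf.prob ?P (?A \<union> ?B)"
      by (intro measure_pmf.finite_measure_Union[symmetric]) auto
    moreover have "measure_pmf.prob ?P (?A \<union> ?B) \<le> 1" by simp
    ultimately show False using elim(3) by linarith
  qed
  then show False by simp
qed

text \<open>With \<open>m\<close> and \<open>\<epsilon>\<close> fixed, \<open>n\<close> tends to
  infinity first, which absorbs the boundary term; only then does \<open>\<epsilon>\<close> tend to
  zero.\<close>

lemma ln_mean_block_size_le:
  assumes "0 \<le> p" "p \<le> 1" "clt_constants p \<mu> \<sigma>" "0 < \<sigma>" "1 \<le> m"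
  shows "ln (mean_block_size p m) / 2 \<le> \<mu>"
proof (rule field_le_epsilon)
  fix \<epsilon> :: real assume "0 < \<epsilon>"
  have "eventually (\<lambda>n. mean_block_size p m * real m / \<epsilon> \<le> real n) sequentially"
    using filterlim_real_sequentially by (simp add: filterlim_at_top)
  then have "eventually (\<lambda>n. measure_pmf.prob (random_graph_order n p)
      {R. (ln (mean_block_size p m) / 2 - \<epsilon>) * real n \<le> ln (real (num_linear_extensions {1..n} R))}
      \<ge> \<epsilon> / (1 + 2 * \<epsilon>)) sequentially"
    using eventually_ge_at_top[of 1]
  proof eventually_elim
    case (elim n)
    then have "mean_block_size p m * real m \<le> \<epsilon> * real n"
      using \<open>0 < \<epsilon>\<close> by (simp add: field_simps)
    then show ?case
      using assms elim \<open>0 < \<epsilon>\<close> by (intro prob_ln_num_linear_extensions_ge)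
  qed
  then have "ln (mean_block_size p m) / 2 - \<epsilon> \<le> \<mu>"
    using \<open>0 < \<epsilon>\<close> by (intro le_if_clt_constants[OF assms(3,4), of "\<epsilon> / (1 + 2 * \<epsilon>)"]) simp_all
  then show "ln (mean_block_size p m) / 2 \<le> \<mu> + \<epsilon>" by simp
qed

theorem theorem6p5p2:
  fixes p \<mu> :: real
  assumes "0 < p" and "p < 1"
    and "\<mu> > 0"
    and "\<exists>\<sigma>>0. clt_constants p \<mu> \<sigma>"
  shows "\<mu> \<ge> - (log 2 (h p) * ln 2) / 2"
proof -
  obtain \<sigma> where \<sigma>: "0 < \<sigma>" "clt_constants p \<mu> \<sigma>" using assms(4) by blast
  let ?f = "antichain_prob p"
  \<comment> \<open>A bound uniform in the finite set \<open>F\<close> yields both the summability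
    of the series and the same bound for its sum.\<close>
  have bound: "sum ?f F \<le> exp (2 * \<mu>)" if F: "finite F" "F \<subseteq> {1..}" for F
  proof -
    obtain k where "\<forall>j\<in>F. j \<le> k"
      using F(1) finite_nat_set_iff_bounded_le by blast
    with F(2) have m: "F \<subseteq> {1..Suc k}" by force
    have "sum ?f F \<le> mean_block_size p (Suc k)"
      unfolding mean_block_size_def using m assms(2)
      by (intro sum_mono2) (auto simp: antichain_prob_nonneg)
    also have "\<dots> = exp (ln (mean_block_size p (Suc k)))"
      using mean_block_size_ge_1[of p "Suc k"] assms(2) by simp
    also have "\<dots> \<le> exp (2 * \<mu>)"
      using ln_mean_block_size_le[OF _ _ \<sigma>(2,1), of "Suc k"] assms(1,2) by simp
    finally show ?thesis .
  qed
  \<comment> \<open>Without summability \<open>infsum\<close> would take its default value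
    0.\<close>
  have summable: "?f summable_on {1..}"
    using assms(2) bound by (intro nonneg_bdd_above_summable_on bdd_aboveI2[of _ _ "exp (2 * \<mu>)"])
      (auto simp: antichain_prob_nonneg)
  define S where "S = infsum ?f {1..}"
  have hS: "h p = inverse S"
    unfolding h_def S_def antichain_prob_def[abs_def] by (rule refl)
  \<comment> \<open>The term at 1 equals 1, which keeps \<open>S\<close> positive for the
    logarithm.\<close>
  have "sum ?f {1} \<le> S"
    unfolding S_def using summable assms(2)
    by (intro finite_sum_le_infsum) (auto simp: antichain_prob_nonneg)
  then have "1 \<le> S" by (simp add: antichain_prob_def)
  moreover have "S \<le> exp (2 * \<mu>)"
    unfolding S_def using summable bound by (rule infsum_le_finite_sums)
  ultimately have "ln S \<le> ln (exp (2 * \<mu>))"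
    by (intro ln_mono) auto
  then show ?thesis
    using \<open>1 \<le> S\<close> by (simp add: hS log_def ln_inverse)
qed

end
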